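(* Let $K$ be a field of characteristic $0$. (i) Let $a=(a_0,a_1,a_2,\dots)$ be a sequence in $K$, let $a(t)=\sum_{n\ge 0}a_nt^n$, and let the polynomials $I_m(x)\in K[x]$, $m\ge 0$, be defined by $$\frac{a(t)}{1+x\,t\,a(t)}=\sum_{m=0}^\infty I_m(x)\,t^m .$$ Then for every integer $k>0$ and every integer $n\ge 1$, the determinant $$\det\big((I_{i+j+k}(x))_{0\le i,j<n}\big)$$ is a polynomial of degree at most $k$ in $x$. (ii) Let $s(x)=s_0+s_1x+s_2x^2+\cdots$ be a formal power series whose coefficients $s_0,s_1,s_2,\dots$ are regarded as (commuting) indeterminates over $K$. Let $P_1(x)=s_0$, $P_m(x)=\lfloor P_{m-1}(x)s(x)\rfloor_m$ for $m\ge 2$, and $Q_m(x)=x^{m-1}P_m(1/x)$ for $m\ge 1$. Then for every integer $n\ge 1$ the determinant $$\det\big((Q_{1+i+j}(x))_{0\le i,j<n}\big),$$ which is a polynomial in $x,s_0,s_1,s_2,\dots$, does not depend on $s_1$.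
   Context: For a formal power series $f(x)=\sum_{j\ge 0}f_jx^j$ and a positive integer $m$, $\lfloor f(x)\rfloor_m=f_0+f_1x+\cdots+f_{m-1}x^{m-1}$. The zero polynomial is considered to have degree at most $k$ for every $k$. *)

theory Defs
  imports
    "HOL-Library.Poly_Mapping"
    "HOL-Computational_Algebra.Polynomial_FPS"
    "Jordan_Normal_Form.Determinant"
begin

definition hankel :: "(nat \<Rightarrow> 'a) \<Rightarrow> nat \<Rightarrow> nat \<Rightarrow> 'a mat" where
  "hankel c k n = mat n n (\<lambda>(i, j). c (i + j + k))"

definition seq_gf :: "(nat \<Rightarrow> 'a::comm_ring_1) \<Rightarrow> 'a poly fps" where
  "seq_gf a = Abs_fps (\<lambda>n. [:a n:])"

text \<open>
  The power series variable \<^term>\<open>fps_X\<close> is \<open>t\<close>, the coefficients are polynomials in \<open>x\<close>.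
  The library has no division on \<^typ>\<open>'a poly fps\<close>, since polynomials have no \<open>inverse\<close>;
  the denominator has constant term 1 and is inverted by \<^const>\<open>fps_right_inverse\<close>, whose
  second argument is the constant term of the inverse.
\<close>

definition I_denom :: "(nat \<Rightarrow> 'a::comm_ring_1) \<Rightarrow> 'a poly fps" where
  "I_denom a = 1 + fps_const [:0, 1:] * fps_X * seq_gf a"

definition I_poly :: "(nat \<Rightarrow> 'a::comm_ring_1) \<Rightarrow> nat \<Rightarrow> 'a poly" where
  "I_poly a m = fps_nth (seq_gf a * fps_right_inverse (I_denom a) 1) m"

lemma I_poly_gf: "Abs_fps (I_poly a) * I_denom a = seq_gf a"
proof -
  have inv: "I_denom a * fps_right_inverse (I_denom a) 1 = 1"
    by (rule fps_right_inverse) (simp add: I_denom_def)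
  have "Abs_fps (I_poly a) = seq_gf a * fps_right_inverse (I_denom a) 1"
    by (simp add: I_poly_def fps_eq_iff)
  then have "Abs_fps (I_poly a) * I_denom a
      = seq_gf a * (I_denom a * fps_right_inverse (I_denom a) 1)"
    by (simp add: mult_ac)
  with inv show ?thesis by simp
qed

definition trunc :: "nat \<Rightarrow> 'a::comm_monoid_add fps \<Rightarrow> 'a poly" where
  "trunc m f = (\<Sum>j<m. monom (fps_nth f j) j)"

text \<open>The value at index 0 is a dummy: the sequence starts at index 1.\<close>

fun P_poly :: "'a::comm_ring_1 fps \<Rightarrow> nat \<Rightarrow> 'a poly" where
  "P_poly s 0 = 0"
| "P_poly s (Suc 0) = [:fps_nth s 0:]"
| "P_poly s (Suc (Suc m)) = trunc (Suc (Suc m)) (fps_of_poly (P_poly s (Suc m)) * s)"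

text \<open>\<open>x\<^sup>m\<^sup>-\<^sup>1 P\<^sub>m(1/x)\<close>; this is a polynomial because \<open>P\<^sub>m\<close> has degree less than \<open>m\<close>.\<close>

definition Q_poly :: "'a::comm_ring_1 fps \<Rightarrow> nat \<Rightarrow> 'a poly" where
  "Q_poly s m = (\<Sum>i<m. monom (coeff (P_poly s m) i) (m - 1 - i))"

lemma coeff_trunc: "coeff (trunc m f) j = (if j < m then fps_nth f j else 0)"
  by (simp add: trunc_def coeff_sum)

lemma coeff_P_poly_ge: "m \<le> i \<Longrightarrow> coeff (P_poly s m) i = 0"
  by (cases "(s, m)" rule: P_poly.cases) (auto simp: coeff_trunc coeff_pCons split: nat.split)

lemma poly_Q_poly:
  assumes "m \<ge> 1" and "z * w = 1"
  shows "poly (Q_poly s m) z = z ^ (m - 1) * poly (P_poly s m) w"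
proof -
  have "degree (P_poly s m) \<le> m - 1"
    using assms(1) by (intro degree_le) (auto intro: coeff_P_poly_ge)
  then have "poly (P_poly s m) w = (\<Sum>i\<le>m - 1. coeff (P_poly s m) i * w ^ i)"
    unfolding poly_altdef by (intro sum.mono_neutral_left) (auto simp: coeff_eq_0)
  also have "{..m - 1} = {..<m}" using assms(1) by auto
  finally have P: "poly (P_poly s m) w = (\<Sum>i<m. coeff (P_poly s m) i * w ^ i)" .
  have pow: "z ^ (m - 1 - i) = z ^ (m - 1) * w ^ i" if "i < m" for i
  proof -
    have "m - 1 = (m - 1 - i) + i" using that by simp
    then have "z ^ (m - 1) = z ^ (m - 1 - i) * z ^ i" by (metis power_add)
    then have "z ^ (m - 1) * w ^ i = z ^ (m - 1 - i) * (z * w) ^ i"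
      by (simp only: power_mult_distrib mult.assoc)
    then show ?thesis by (simp add: assms(2))
  qed
  have "poly (Q_poly s m) z = (\<Sum>i<m. coeff (P_poly s m) i * z ^ (m - 1 - i))"
    by (simp add: Q_poly_def poly_sum poly_monom)
  also have "\<dots> = (\<Sum>i<m. z ^ (m - 1) * (coeff (P_poly s m) i * w ^ i))"
    by (intro sum.cong refl) (simp only: lessThan_iff pow mult.left_commute)
  also have "\<dots> = z ^ (m - 1) * poly (P_poly s m) w"
    by (simp only: P sum_distrib_left)
  finally show ?thesis .
qed

text \<open>
  \<open>K[s\<^sub>0, s\<^sub>1, s\<^sub>2, \<dots>]\<close>: a monomial is a finitely supported exponent function, a polynomial a
  finitely supported function from monomials to coefficients; multiplication on
  \<^type>\<open>poly_mapping\<close> is convolution.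
\<close>

type_synonym 'a mpoly_nat = "(nat \<Rightarrow>\<^sub>0 nat) \<Rightarrow>\<^sub>0 'a"

definition indet :: "nat \<Rightarrow> 'a::comm_ring_1 mpoly_nat" where
  "indet j = Poly_Mapping.single (Poly_Mapping.single j 1) 1"

definition generic_fps :: "'a::comm_ring_1 mpoly_nat fps" where
  "generic_fps = Abs_fps indet"

text \<open>For \<open>D \<in> K[s\<^sub>0, s\<^sub>1, \<dots>][x]\<close>: the indeterminate \<open>s\<^sub>v\<close> does not occur in \<open>D\<close>.\<close>

definition independent_of :: "nat \<Rightarrow> 'a::comm_ring_1 mpoly_nat poly \<Rightarrow> bool" where
  "independent_of v D \<longleftrightarrow>
     (\<forall>i. \<forall>mon \<in> Poly_Mapping.keys (coeff D i). Poly_Mapping.lookup mon v = 0)"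

end

theory Submission
  imports Defs
begin

text \<open>
  (i) Put \<open>c = a / (1 + x t a)\<close>. A minor of the lower triangular Toeplitz matrix of \<open>c\<close> is the
  shifted Hankel determinant up to sign. Since \<open>1 - x t c\<close> is the inverse of \<open>1 + x t a\<close>, that minor
  equals, in the spirit of Jacobi's complementary minor theorem, the determinant of a matrix whose
  rows are rows of the Toeplitz matrices of \<open>a\<close> and of \<open>1 + x t a\<close>. Row \<open>i\<close> of the latter is the
  \<open>i\<close>-th unit vector plus \<open>x\<close> times row \<open>i - 1\<close> of the former, so row operations remove \<open>x\<close>
  from all but \<open>k\<close> rows.

  (ii) Write \<open>s(x) = r(x) + s\<^sub>1 x\<close>. Pascal's rule shows that \<open>Q\<^sub>1, Q\<^sub>2, \<dots>\<close> is the binomial transform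
  with parameter \<open>s\<^sub>1\<close> of the corresponding sequence for \<open>r\<close>, and Hankel determinants are invariant
  under the binomial transform.
\<close>

section \<open>Determinants of polynomial matrices\<close>

text \<open>Each term of the Leibniz expansion takes exactly one entry from every row, so bounds
  that depend only on the row add up.\<close>

lemma degree_det_le:
  fixes A :: "'a::comm_ring_1 poly mat"
  assumes A: "A \<in> carrier_mat n n"
    and d: "\<And>i j. i < n \<Longrightarrow> j < n \<Longrightarrow> degree (A $$ (i, j)) \<le> d i"
  shows "degree (det A) \<le> (\<Sum>i<n. d i)"
  unfolding det_def'[OF A]
proof (rule degree_sum_le)
  show "finite {p. p permutes {0..<n}}" by (simp add: finite_permutations)
next
  fix p assume "p \<in> {p. p permutes {0..<n}}"
  then have p: "p permutes {0..<n}" by simp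
  have "degree (\<Prod>i = 0..<n. A $$ (i, p i)) \<le> (\<Sum>i = 0..<n. degree (A $$ (i, p i)))"
    using degree_prod_sum_le[of "{0..<n}" "\<lambda>i. A $$ (i, p i)"] by (simp add: o_def)
  also have "\<dots> \<le> (\<Sum>i = 0..<n. d i)"
    using permutes_in_image[OF p] by (intro sum_mono d) auto
  also have "\<dots> = (\<Sum>i<n. d i)" by (simp add: lessThan_atLeast0)
  finally have *: "degree (\<Prod>i = 0..<n. A $$ (i, p i)) \<le> (\<Sum>i<n. d i)" .
  show "degree (signof p * (\<Prod>i = 0..<n. A $$ (i, p i))) \<le> (\<Sum>i<n. d i)"
    using * by (cases "evenperm p") (simp_all add: sign_def)
qed

lemma det_unit_lower_triangular:
  fixes A :: "'a::comm_ring_1 mat"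
  assumes A: "A \<in> carrier_mat n n"
    and up: "\<And>i j. i < j \<Longrightarrow> j < n \<Longrightarrow> A $$ (i, j) = 0"
    and diag: "\<And>i. i < n \<Longrightarrow> A $$ (i, i) = 1"
  shows "det A = 1"
proof -
  have "det A = prod_list (diag_mat A)"
    by (rule det_lower_triangular[OF up A])
  also have "diag_mat A = map (\<lambda>_. 1) [0..<n]"
    using A diag by (auto simp: diag_mat_def)
  finally show ?thesis by (simp add: map_replicate_const)
qed

section \<open>Truncated Toeplitz matrices\<close>

definition toeplitz_entry :: "'a::zero fps \<Rightarrow> nat \<Rightarrow> nat \<Rightarrow> 'a" where
  "toeplitz_entry f i j = (if j \<le> i then fps_nth f (i - j) else 0)"

text \<open>Lower triangular Toeplitz matrices multiply like their series. Row \<open>i\<close>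
  reaches only columns up to \<open>i\<close>, so a cut-off at any \<open>N > i\<close> loses no
  term.\<close>

lemma sum_toeplitz_entry:
  fixes f g :: "'a::comm_ring_1 fps"
  assumes "i < N"
  shows "(\<Sum>j<N. toeplitz_entry f i j * toeplitz_entry g j l) = toeplitz_entry (f * g) i l"
proof (cases "l \<le> i")
  case True
  have "(\<Sum>j<N. toeplitz_entry f i j * toeplitz_entry g j l)
      = (\<Sum>j\<in>{l..i}. fps_nth f (i - j) * fps_nth g (j - l))"
    using assms True by (intro sum.mono_neutral_cong_right) (auto simp: toeplitz_entry_def)
  also have "\<dots> = (\<Sum>j = 0..i - l. fps_nth f j * fps_nth g (i - l - j))"
    using True by (intro sum.reindex_bij_witness[of _ "\<lambda>j. i - j" "\<lambda>j. i - j"])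
      (auto simp: algebra_simps)
  finally show ?thesis using True by (simp add: toeplitz_entry_def fps_mult_nth)
next
  case False
  then show ?thesis by (auto simp: toeplitz_entry_def intro!: sum.neutral)
qed

section \<open>Degree of the shifted Hankel determinants\<close>

lemma degree_det_hankel_I_poly:
  fixes a :: "nat \<Rightarrow> 'a::idom"
  assumes n: "n \<ge> 1"
  shows "degree (det (hankel (I_poly a) k n)) \<le> k"
proof -
  define x :: "'a poly" where "x = [:0, 1:]"
  \<comment> \<open>With its columns reversed, the Hankel matrix is the block of rows m to m + n - 1
    and columns 0 to n - 1 of the Toeplitz matrix of \<open>C\<close>. The least size containing
    this block is N = m + n.\<close>
  define N where "N = 2 * n + k - 1"
  define m where "m = n + k - 1"
  define A where "A = seq_gf a"
  define C where "C = Abs_fps (I_poly a)"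
  define D where "D = 1 + fps_const x * fps_X * A"
  define E where "E = 1 - fps_const x * fps_X * C"
  have Nm: "N = n + m" "m + 1 = n + k" using n by (auto simp: N_def m_def)
  have CD: "C * D = A"
    using I_poly_gf[of a] by (simp add: C_def D_def A_def I_denom_def x_def)
  have DE: "D * E = 1"
  proof -
    have "D * E = D - fps_const x * fps_X * (C * D)" by (simp add: E_def algebra_simps)
    also have "\<dots> = 1" by (simp only: CD) (simp add: D_def)
    finally show ?thesis .
  qed
  have AE: "A * E = C"
    by (metis CD DE mult.assoc mult.right_neutral)
  \<comment> \<open>Row degrees of \<open>M\<close>: x survives only in rows n to m, and there are m
    + 1 - n = k of them.\<close>
  define d where "d = (\<lambda>i. if n \<le> i \<and> i \<le> m then 1 else (0::nat))"
  define M where "M = mat N N (\<lambda>(i, j).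
    if i < n then toeplitz_entry A (m + i) j
    else if i \<le> m then toeplitz_entry D i j else if i = j then 1 else 0)"
  \<comment> \<open>\<open>R\<close> undoes the row operations: \<open>R * M\<close> restores the rows of \<open>1 + x t a\<close> below row \<open>m\<close>.\<close>
  define R where "R = mat N N (\<lambda>(i, j). if i = j then 1
    else if m < i \<and> j = i - 1 - m then x else 0)"
  define U where "U = mat N N (\<lambda>(i, j). toeplitz_entry E i j)"
  \<comment> \<open>By \<open>AE\<close> and \<open>DE\<close>, multiplying by \<open>U\<close>
    turns the first n rows of \<open>V\<close> into rows m to m + n - 1 of the Toeplitz matrix of
    \<open>C\<close> and all later rows into unit vectors, which leaves the minor
    \<open>L\<close>.\<close>
  define V where "V = mat N N (\<lambda>(i, j).
    if i < n then toeplitz_entry A (m + i) j else toeplitz_entry D i j)"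
  define L where "L = mat n n (\<lambda>(i, j). toeplitz_entry C (m + i) j)"
  \<comment> \<open>\<open>J\<close> reverses the columns, turning the Hankel matrix into the Toeplitz block \<open>L\<close>.\<close>
  define J where "J = mat n n (\<lambda>(i, j). if j = n - 1 - i then 1 else 0 :: 'a poly)"
  let ?H = "hankel (I_poly a) k n"
  have carr [simp]: "M \<in> carrier_mat N N" "R \<in> carrier_mat N N" "U \<in> carrier_mat N N"
    "V \<in> carrier_mat N N" "L \<in> carrier_mat n n" "J \<in> carrier_mat n n" "?H \<in> carrier_mat n n"
    by (auto simp: M_def R_def U_def V_def L_def J_def hankel_def)
  have entry_D: "toeplitz_entry D i j
      = (if i = j then 1 else 0) + (if j < i then x * toeplitz_entry A (i - 1) j else 0)" for i j
    by (auto simp: toeplitz_entry_def D_def mult.assoc)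
  have RM: "R * M = V"
  proof (rule eq_matI)
    fix i j assume "i < dim_row V" "j < dim_col V"
    then have ij: "i < N" "j < N" by (auto simp: V_def)
    have "(R * M) $$ (i, j) = (\<Sum>l<N. R $$ (i, l) * M $$ (l, j))"
      using ij by (simp add: scalar_prod_def R_def M_def lessThan_atLeast0)
    also have "\<dots> = (\<Sum>l<N. (if l = i then M $$ (i, j) else 0)
        + (if l = i - 1 - m then if m < i then x * M $$ (l, j) else 0 else 0))"
      using ij n Nm by (intro sum.cong) (auto simp: R_def)
    also have "\<dots> = M $$ (i, j) + (if m < i then x * M $$ (i - 1 - m, j) else 0)"
      using ij by (simp add: sum.distrib less_imp_diff_less)
    also have "\<dots> = V $$ (i, j)"
    proof (cases "m < i")
      \<comment> \<open>By \<open>entry_D\<close>, row i needs x times row i - 1 of the Toeplitz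
        matrix of \<open>A\<close>. That row sits in \<open>M\<close> at index i - 1 - m, which is
        below n because i < n + m.\<close>
      case True
      then have "\<not> i < n" "i - 1 - m < n" "i - 1 - m < N" "m + (i - 1 - m) = i - 1"
        using ij n Nm by auto
      then show ?thesis
        using True ij by (auto simp: M_def V_def entry_D toeplitz_entry_def[of A])
    next
      case False
      then show ?thesis using ij by (auto simp: M_def V_def)
    qed
    finally show "(R * M) $$ (i, j) = V $$ (i, j)" .
  qed (auto simp: R_def M_def V_def)
  have VU: "V * U = four_block_mat L (mat n m (\<lambda>(i, j). toeplitz_entry C (m + i) (n + j)))
      (0\<^sub>m m n) (1\<^sub>m m)" (is "_ = ?B")
  proof (rule eq_matI)
    fix i j assume "i < dim_row ?B" "j < dim_col ?B"
    then have ij: "i < N" "j < N" by (auto simp: L_def Nm)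
    have "(V * U) $$ (i, j) = (\<Sum>l<N. V $$ (i, l) * U $$ (l, j))"
      using ij by (simp add: scalar_prod_def V_def U_def lessThan_atLeast0)
    also have "\<dots> = (\<Sum>l<N. (if i < n then toeplitz_entry A (m + i) l
        else toeplitz_entry D i l) * toeplitz_entry E l j)"
      using ij by (intro sum.cong) (auto simp: V_def U_def)
    also have "\<dots> = (if i < n then toeplitz_entry C (m + i) j else toeplitz_entry 1 i j)"
      using ij Nm by (simp add: sum_toeplitz_entry AE DE)
    also have "\<dots> = ?B $$ (i, j)"
      using ij Nm by (auto simp: L_def toeplitz_entry_def)
    finally show "(V * U) $$ (i, j) = ?B $$ (i, j)" .
  qed (auto simp: V_def U_def L_def Nm)
  have "det (V * U) = det L"
    unfolding VU by (subst det_four_block_mat_lower_left_zero[of _ n _ m]) auto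
  moreover have "det R = 1"
    by (rule det_unit_lower_triangular[of _ N]) (auto simp: R_def)
  moreover have "det U = 1"
    by (rule det_unit_lower_triangular[of _ N]) (auto simp: U_def toeplitz_entry_def E_def)
  ultimately have detL: "det L = det M"
    by (metis RM carr det_mult mult.left_neutral mult.right_neutral)
  have "?H * J = L"
  proof (rule eq_matI)
    fix i j assume "i < dim_row L" "j < dim_col L"
    then have ij: "i < n" "j < n" by (auto simp: L_def)
    have "(?H * J) $$ (i, j) = (\<Sum>l<n. ?H $$ (i, l) * J $$ (l, j))"
      using ij by (simp add: scalar_prod_def J_def hankel_def lessThan_atLeast0)
    also have "\<dots> = (\<Sum>l<n. if l = n - 1 - j then ?H $$ (i, l) else 0)"
      using ij by (intro sum.cong) (auto simp: J_def)
    also have "\<dots> = I_poly a (i + (n - 1 - j) + k)"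
      using ij by (simp add: hankel_def)
    also have "i + (n - 1 - j) + k = m + i - j" using ij Nm by auto
    also have "I_poly a (m + i - j) = L $$ (i, j)"
      using ij Nm n by (auto simp: L_def toeplitz_entry_def C_def)
    finally show "(?H * J) $$ (i, j) = L $$ (i, j)" .
  qed (auto simp: hankel_def J_def L_def)
  then have HJ: "det ?H * det J = det L"
    by (metis det_mult[of _ n] carr)
  \<comment> \<open>Since \<open>det J\<close> squares to 1, it can be moved across
    \<open>HJ\<close> without computing the sign of the reversal; being of degree 0, it does not
    raise the degree.\<close>
  have "J * J = 1\<^sub>m n"
  proof (rule eq_matI)
    fix i j assume "i < dim_row (1\<^sub>m n :: 'a poly mat)" "j < dim_col (1\<^sub>m n :: 'a poly mat)"
    then have ij: "i < n" "j < n" by auto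
    have "(J * J) $$ (i, j) = (\<Sum>l<n. J $$ (i, l) * J $$ (l, j))"
      using ij by (simp add: scalar_prod_def J_def lessThan_atLeast0)
    also have "\<dots> = (\<Sum>l<n. if l = n - 1 - j then J $$ (i, l) else 0)"
      using ij by (intro sum.cong) (auto simp: J_def)
    also have "\<dots> = 1\<^sub>m n $$ (i, j)" using ij by (auto simp: J_def)
    finally show "(J * J) $$ (i, j) = 1\<^sub>m n $$ (i, j)" .
  qed (auto simp: J_def)
  then have "det J * det J = 1" by (metis det_mult[of _ n] carr det_one)
  then have "det ?H = det M * det J"
    by (metis HJ detL mult.assoc mult.right_neutral)
  moreover have "degree (det J) \<le> (\<Sum>i<n. 0)"
    by (rule degree_det_le) (auto simp: J_def)
  moreover have "degree (det M) \<le> (\<Sum>i<N. d i)"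
  proof (rule degree_det_le)
    fix i j assume ij: "i < N" "j < N"
    have deg_A: "degree (toeplitz_entry A r j) \<le> 0" for r
      by (simp add: toeplitz_entry_def A_def seq_gf_def)
    have "degree (x * toeplitz_entry A (i - 1) j) \<le> 1"
      using degree_mult_le[of x "toeplitz_entry A (i - 1) j"] deg_A[of "i - 1"]
      by (simp add: x_def)
    then have deg_D: "degree (toeplitz_entry D i j) \<le> 1"
      unfolding entry_D by (intro degree_add_le) auto
    show "degree (M $$ (i, j)) \<le> d i"
      using ij deg_A deg_D by (auto simp: M_def d_def)
  qed simp
  moreover have "(\<Sum>i<N. d i) = (\<Sum>i\<in>{n..m}. 1)"
    using Nm n by (intro sum.mono_neutral_cong_right) (auto simp: d_def)
  ultimately show ?thesis
    using degree_mult_le[of "det M" "det J"] Nm by simp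
qed

section \<open>Invariance under the binomial transform\<close>

text \<open>Grouping by l = p + q gives the common power e^(i + j - l), and Vandermonde's identity
  sums the binomial products.\<close>

lemma binomial_transform_add:
  fixes d :: "nat \<Rightarrow> 'a::comm_ring_1"
  shows "(\<Sum>p\<le>i. \<Sum>q\<le>j. of_nat (i choose p) * e ^ (i - p) * d (p + q)
            * (of_nat (j choose q) * e ^ (j - q)))
       = (\<Sum>l\<le>i + j. of_nat ((i + j) choose l) * e ^ (i + j - l) * d l)"
proof -
  define h where "h = (\<lambda>p q. of_nat (i choose p) * e ^ (i - p) * d (p + q)
            * (of_nat (j choose q) * e ^ (j - q)))"
  have h_nz: "p \<le> i \<and> q \<le> j" if "h p q \<noteq> 0" for p q
    using that by (auto simp: h_def not_le binomial_eq_0 intro: ccontr)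
  have "(\<Sum>p\<le>i. \<Sum>q\<le>j. h p q) = sum (\<lambda>(p, q). h p q) ({..i} \<times> {..j})"
    by (simp add: sum.cartesian_product)
  \<comment> \<open>The rectangle is enlarged to a triangle, where summation along the diagonals is
    available; the added terms contain a vanishing binomial coefficient.\<close>
  also have "\<dots> = sum (\<lambda>(p, q). h p q) {(p, q). p + q \<le> i + j}"
  proof (rule sum.mono_neutral_left)
    show "finite {(p, q). p + q \<le> i + j}"
      by (rule finite_subset[of _ "{..i + j} \<times> {..i + j}"]) auto
  qed (auto dest: h_nz)
  also have "\<dots> = (\<Sum>l\<le>i + j. \<Sum>p\<le>l. h p (l - p))"
    by (rule sum.triangle_reindex_eq)
  also have "\<dots> = (\<Sum>l\<le>i + j. of_nat ((i + j) choose l) * e ^ (i + j - l) * d l)"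
  proof (rule sum.cong)
    fix l assume "l \<in> {..i + j}"
    have "h p (l - p)
        = of_nat ((i choose p) * (j choose (l - p))) * (e ^ (i + j - l) * d l)"
      if "p \<le> l" for p
    proof (cases "p \<le> i \<and> l - p \<le> j")
      case True
      then have "i + j - l = (i - p) + (j - (l - p))" using that by auto
      then show ?thesis using that by (simp add: h_def power_add algebra_simps)
    next
      case False
      then have "(i choose p) = 0 \<or> (j choose (l - p)) = 0"
        by (auto simp: binomial_eq_0)
      then show ?thesis by (auto simp: h_def simp del: binomial_eq_0_iff)
    qed
    then have "(\<Sum>p\<le>l. h p (l - p))
        = of_nat (\<Sum>p\<le>l. (i choose p) * (j choose (l - p))) * (e ^ (i + j - l) * d l)"
      by (simp add: sum_distrib_right)
    then show "(\<Sum>p\<le>l. h p (l - p)) = of_nat ((i + j) choose l) * e ^ (i + j - l) * d l"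
      by (simp only: vandermonde mult.assoc)
  qed simp
  finally show ?thesis by (simp add: h_def)
qed

text \<open>The two Hankel matrices are congruent through a unit triangular Pascal matrix weighted
  by powers of \<open>e\<close>; \<open>binomial_transform_add\<close> computes the entries of the
  product.\<close>

lemma det_hankel_binomial_transform:
  fixes c d :: "nat \<Rightarrow> 'a::comm_ring_1"
  assumes c: "\<And>m. c (m + k) = (\<Sum>l\<le>m. of_nat (m choose l) * e ^ (m - l) * d (l + k))"
  shows "det (hankel c k n) = det (hankel d k n)"
proof -
  define B where "B = mat n n (\<lambda>(i, j). of_nat (i choose j) * e ^ (i - j))"
  have B [simp]: "B \<in> carrier_mat n n" "hankel d k n \<in> carrier_mat n n"
    by (auto simp: B_def hankel_def)
  \<comment> \<open>\<open>B\<close> is lower triangular, so cutting it off at size \<open>n\<close> loses nothing.\<close>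
  have "B * hankel d k n * transpose_mat B = hankel c k n" (is "?L = ?R")
  proof (rule eq_matI)
    fix i j assume "i < dim_row ?R" "j < dim_col ?R"
    then have ij: "i < n" "j < n" by (auto simp: hankel_def)
    have "?L $$ (i, j) = (\<Sum>q<n. \<Sum>p<n. B $$ (i, p) * d (p + q + k) * B $$ (j, q))"
      using ij by (simp add: scalar_prod_def B_def hankel_def lessThan_atLeast0 sum_distrib_right)
    also have "\<dots> = (\<Sum>p<n. \<Sum>q<n. B $$ (i, p) * d (p + q + k) * B $$ (j, q))"
      by (rule sum.swap)
    also have "\<dots> = (\<Sum>p\<le>i. \<Sum>q\<le>j. B $$ (i, p) * d (p + q + k) * B $$ (j, q))"
      using ij by (intro sum.mono_neutral_cong_right)
        (auto simp: B_def binomial_eq_0 intro!: sum.mono_neutral_cong_right)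
    also have "\<dots> = (\<Sum>p\<le>i. \<Sum>q\<le>j. of_nat (i choose p) * e ^ (i - p) * d (p + q + k)
            * (of_nat (j choose q) * e ^ (j - q)))"
      using ij by (intro sum.cong refl) (auto simp: B_def)
    also have "\<dots> = c (i + j + k)"
      using binomial_transform_add[where d = "\<lambda>l. d (l + k)"] by (simp add: c)
    finally show "?L $$ (i, j) = ?R $$ (i, j)" using ij by (simp add: hankel_def)
  qed (auto simp: B_def hankel_def)
  moreover have "det B = 1"
    by (rule det_unit_lower_triangular[of _ n]) (auto simp: B_def binomial_eq_0)
  moreover have "det (B * hankel d k n * transpose_mat B)
      = det B * det (hankel d k n) * det (transpose_mat B)"
    by (simp only: det_mult[of _ n] B mult_carrier_mat[of _ n n] transpose_carrier_mat)
  ultimately show ?thesis by (simp add: det_transpose[of _ n])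
qed

section \<open>Dependence of the truncated powers on the linear coefficient\<close>

lemma trunc_add: "trunc m (f + g) = trunc m f + trunc m g"
  by (simp add: poly_eq_iff coeff_trunc)

lemma trunc_sum: "trunc m (\<Sum>i\<in>S. f i) = (\<Sum>i\<in>S. trunc m (f i))"
  by (rule poly_eqI) (simp add: coeff_trunc fps_sum_nth coeff_sum)

text \<open>Pulling out x^l lowers the truncation order by l, in step with the index of
  \<open>P_poly r\<close> in \<open>P_poly_add_linear\<close>.\<close>

lemma trunc_monom_mult:
  fixes f :: "'a::comm_ring_1 fps"
  assumes "l \<le> m"
  shows "trunc m (fps_of_poly (monom c l) * f) = monom c l * trunc (m - l) f"
proof -
  have "fps_of_poly (monom c l) * f = fps_const c * (fps_X ^ l * f)"
    by (simp add: fps_of_poly_monom mult.assoc)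
  then show ?thesis
    using assms by (auto simp: poly_eq_iff coeff_trunc coeff_monom_mult fps_X_power_mult_nth)
qed

lemma trunc_P_poly: "trunc m (fps_of_poly (P_poly s m)) = P_poly s m"
  using coeff_P_poly_ge[of m _ s] by (auto simp: poly_eq_iff coeff_trunc)

lemma sum_pascal:
  fixes g :: "nat \<Rightarrow> 'a::comm_ring_1"
  shows "(\<Sum>l\<le>Suc m. of_nat (Suc m choose l) * g l)
    = (\<Sum>l\<le>m. of_nat (m choose l) * g l) + (\<Sum>l\<le>m. of_nat (m choose l) * g (Suc l))"
proof -
  have "(\<Sum>l\<le>Suc m. of_nat (Suc m choose l) * g l)
      = g 0 + (\<Sum>l\<le>m. of_nat (Suc m choose Suc l) * g (Suc l))"
    by (subst sum.atMost_Suc_shift) simp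
  also have "\<dots> = (g 0 + (\<Sum>l\<le>m. of_nat (m choose Suc l) * g (Suc l)))
      + (\<Sum>l\<le>m. of_nat (m choose l) * g (Suc l))"
    by (simp add: sum.distrib algebra_simps)
  also have "g 0 + (\<Sum>l\<le>m. of_nat (m choose Suc l) * g (Suc l))
      = (\<Sum>l\<le>Suc m. of_nat (m choose l) * g l)"
    by (subst sum.atMost_Suc_shift) simp
  also have "\<dots> = (\<Sum>l\<le>m. of_nat (m choose l) * g l)" by (simp add: binomial_eq_0)
  finally show ?thesis .
qed

lemma fps_of_poly_of_nat: "fps_of_poly (of_nat n) = of_nat n"
  by (induction n) (simp_all add: fps_of_poly_add)

lemma monom_of_nat_mult: "monom (of_nat n * c) l = of_nat n * monom c l"
  by (simp add: of_nat_poly smult_monom)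

text \<open>A truncated binomial expansion of powers of r + e x. Multiplying a summand by r advances
  the recursion for r; multiplying it by e x raises l and the truncation order together, so the
  factor \<open>P_poly r\<close> is kept. Pascal's rule merges the two families.\<close>

lemma P_poly_add_linear:
  fixes r :: "'a::comm_ring_1 fps"
  assumes s: "s = r + fps_const e * fps_X"
  shows "P_poly s (Suc m)
    = (\<Sum>l\<le>m. of_nat (m choose l) * (monom (e ^ l) l * P_poly r (Suc m - l)))"
proof (induction m)
  case 0
  then show ?case by (simp add: s monom_0)
next
  case (Suc m)
  define F where "F = (\<lambda>l. fps_of_poly (P_poly r (Suc m - l)))"
  define g where "g = (\<lambda>l. monom (e ^ l) l * P_poly r (Suc (Suc m) - l))"
  have e: "fps_const e * fps_X = fps_of_poly (monom e 1)"
    by (simp add: fps_of_poly_monom)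
  have "fps_of_poly (P_poly s (Suc m)) * s
      = (\<Sum>l\<le>m. of_nat (m choose l) * (fps_of_poly (monom (e ^ l) l) * F l)) * s"
    by (simp add: Suc.IH fps_of_poly_sum fps_of_poly_mult fps_of_poly_of_nat F_def)
  also have "\<dots> = (\<Sum>l\<le>m. fps_of_poly (monom (of_nat (m choose l) * e ^ l) l) * (F l * r)
        + fps_of_poly (monom (of_nat (m choose l) * e ^ Suc l) (Suc l)) * F l)"
    unfolding sum_distrib_right
  proof (intro sum.cong refl)
    fix l
    have "fps_of_poly (monom (of_nat (m choose l) * e ^ Suc l) (Suc l))
        = of_nat (m choose l) * fps_of_poly (monom (e ^ l) l) * (fps_const e * fps_X)"
      by (simp add: e monom_of_nat_mult mult_monom mult.assoc power_Suc2 del: power_Suc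
          flip: fps_of_poly_mult fps_of_poly_of_nat)
    moreover have "fps_of_poly (monom (of_nat (m choose l) * e ^ l) l)
        = of_nat (m choose l) * fps_of_poly (monom (e ^ l) l)"
      by (simp only: monom_of_nat_mult fps_of_poly_mult fps_of_poly_of_nat)
    ultimately show "of_nat (m choose l) * (fps_of_poly (monom (e ^ l) l) * F l) * s
      = fps_of_poly (monom (of_nat (m choose l) * e ^ l) l) * (F l * r)
        + fps_of_poly (monom (of_nat (m choose l) * e ^ Suc l) (Suc l)) * F l"
      by (simp only: s distrib_left distrib_right mult_ac)
  qed
  finally have *: "fps_of_poly (P_poly s (Suc m)) * s = \<dots>" .
  \<comment> \<open>As l <= m, the index \<open>Suc m - l\<close> is positive, so the recursive
    clause of \<open>P_poly\<close> applies and the dummy value at 0 is never reached.\<close>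
  have step: "trunc (Suc (Suc m)) (fps_of_poly (monom c l) * (F l * r))
      = monom c l * P_poly r (Suc (Suc m) - l)" if "l \<le> m" for c l
  proof -
    have "Suc (Suc m) - l = Suc (Suc (m - l))" "Suc m - l = Suc (m - l)" using that by auto
    then show ?thesis using that by (simp add: trunc_monom_mult F_def)
  qed
  have step': "trunc (Suc (Suc m)) (fps_of_poly (monom c (Suc l)) * F l)
      = monom c (Suc l) * P_poly r (Suc m - l)" if "l \<le> m" for c l
    using that by (simp add: trunc_monom_mult F_def trunc_P_poly)
  have "P_poly s (Suc (Suc m))
      = (\<Sum>l\<le>m. monom (of_nat (m choose l) * e ^ l) l * P_poly r (Suc (Suc m) - l)
        + monom (of_nat (m choose l) * e ^ Suc l) (Suc l) * P_poly r (Suc m - l))"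
    by (simp only: P_poly.simps * trunc_sum trunc_add) (simp add: step step')
  also have "\<dots> = (\<Sum>l\<le>m. of_nat (m choose l) * g l) + (\<Sum>l\<le>m. of_nat (m choose l) * g (Suc l))"
    by (simp add: sum.distrib g_def monom_of_nat_mult mult.assoc del: power_Suc)
  also have "\<dots> = (\<Sum>l\<le>Suc m. of_nat (Suc m choose l) * g l)"
    by (rule sum_pascal[symmetric])
  finally show ?case by (simp only: g_def)
qed

lemma coeff_Q_poly: "coeff (Q_poly s (Suc m)) j = (if j \<le> m then coeff (P_poly s (Suc m)) (m - j) else 0)"
proof -
  have "coeff (Q_poly s (Suc m)) j
      = (\<Sum>i<Suc m. if i = m - j then if j \<le> m then coeff (P_poly s (Suc m)) i else 0 else 0)"
    unfolding Q_poly_def coeff_sum by (intro sum.cong) auto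
  then show ?thesis by simp
qed

text \<open>Reversal cancels the factor x^l: x^m (1/x)^l P(1/x) = x^(m - l) P(1/x). Hence the
  weights become constants in x, as the binomial transform requires.\<close>

lemma Q_poly_add_linear:
  fixes r :: "'a::comm_ring_1 fps"
  assumes s: "s = r + fps_const e * fps_X"
  shows "Q_poly s (m + 1) = (\<Sum>l\<le>m. of_nat (m choose l) * [:e:] ^ (m - l) * Q_poly r (l + 1))"
proof -
  have "Q_poly s (Suc m)
      = (\<Sum>l\<le>m. Polynomial.smult (of_nat (m choose l) * e ^ l) (Q_poly r (Suc (m - l))))"
  proof (rule poly_eqI)
    fix j
    have P: "P_poly s (Suc m)
        = (\<Sum>l\<le>m. Polynomial.smult (of_nat (m choose l)) (monom (e ^ l) l * P_poly r (Suc (m - l))))"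
      unfolding P_poly_add_linear[OF s]
      by (intro sum.cong) (auto simp: of_nat_poly Suc_diff_le)
    show "coeff (Q_poly s (Suc m)) j
      = coeff (\<Sum>l\<le>m. Polynomial.smult (of_nat (m choose l) * e ^ l) (Q_poly r (Suc (m - l)))) j"
    proof (cases "j \<le> m")
      case True
      have "coeff (Q_poly s (Suc m)) j = (\<Sum>l\<le>m. of_nat (m choose l)
          * coeff (monom (e ^ l) l * P_poly r (Suc (m - l))) (m - j))"
        using True by (simp add: coeff_Q_poly P coeff_sum)
      \<comment> \<open>When l > m - j, both sides contribute 0: the monomial is too high on the
        left, and j exceeds m - l on the right.\<close>
      also have "\<dots> = (\<Sum>l\<le>m. of_nat (m choose l) * e ^ l * coeff (Q_poly r (Suc (m - l))) j)"
        using True by (intro sum.cong)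
          (auto simp: coeff_monom_mult coeff_Q_poly mult.assoc add.commute)
      finally show ?thesis by (simp add: coeff_sum)
    next
      case False
      then show ?thesis by (auto simp: coeff_Q_poly coeff_sum intro!: sum.neutral)
    qed
  qed
  also have "\<dots> = (\<Sum>l\<le>m. Polynomial.smult (of_nat (m choose l) * e ^ (m - l)) (Q_poly r (Suc l)))"
    by (rule sum.reindex_bij_witness[of _ "\<lambda>l. m - l" "\<lambda>l. m - l"])
      (auto simp flip: binomial_symmetric)
  also have "\<dots> = (\<Sum>l\<le>m. of_nat (m choose l) * [:e:] ^ (m - l) * Q_poly r (l + 1))"
    by (simp add: of_nat_poly poly_const_pow mult.commute mult.assoc)
  finally show ?thesis by simp
qed

section \<open>Polynomials free of an indeterminate\<close>

text \<open>The condition on a single coefficient, where closure under sums and products can be read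
  off from the monomials.\<close>

definition mpoly_free :: "nat \<Rightarrow> 'a::comm_ring_1 mpoly_nat \<Rightarrow> bool" where
  "mpoly_free v f \<longleftrightarrow> (\<forall>mon \<in> Poly_Mapping.keys f. Poly_Mapping.lookup mon v = 0)"

lemma mpoly_free_0 [simp]: "mpoly_free v 0"
  by (simp add: mpoly_free_def)

lemma mpoly_free_1 [simp]: "mpoly_free v 1"
  by (simp add: mpoly_free_def)

lemma mpoly_free_uminus [simp]: "mpoly_free v (- f) \<longleftrightarrow> mpoly_free v f"
  by (simp add: mpoly_free_def)

lemma mpoly_free_add: "mpoly_free v f \<Longrightarrow> mpoly_free v g \<Longrightarrow> mpoly_free v (f + g)"
  using keys_add[of f g] by (auto simp: mpoly_free_def)

lemma mpoly_free_mult: "mpoly_free v f \<Longrightarrow> mpoly_free v g \<Longrightarrow> mpoly_free v (f * g)"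
  using keys_mult[of f g] by (fastforce simp: mpoly_free_def lookup_add)

lemma mpoly_free_sum: "(\<And>i. i \<in> S \<Longrightarrow> mpoly_free v (f i)) \<Longrightarrow> mpoly_free v (\<Sum>i\<in>S. f i)"
  by (induction S rule: infinite_finite_induct) (auto intro: mpoly_free_add)

lemma mpoly_free_indet: "j \<noteq> v \<Longrightarrow> mpoly_free v (indet j)"
  by (auto simp: mpoly_free_def indet_def lookup_single)

lemma independent_of_altdef: "independent_of v D \<longleftrightarrow> (\<forall>i. mpoly_free v (coeff D i))"
  by (simp add: independent_of_def mpoly_free_def)

lemma independent_of_mult:
  "independent_of v p \<Longrightarrow> independent_of v q \<Longrightarrow> independent_of v (p * q)"
  by (simp add: independent_of_altdef coeff_mult mpoly_free_sum mpoly_free_mult)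

lemma independent_of_sum:
  "(\<And>i. i \<in> S \<Longrightarrow> independent_of v (f i)) \<Longrightarrow> independent_of v (\<Sum>i\<in>S. f i)"
  by (simp add: independent_of_altdef coeff_sum mpoly_free_sum)

lemma independent_of_prod:
  "(\<And>i. i \<in> S \<Longrightarrow> independent_of v (f i)) \<Longrightarrow> independent_of v (\<Prod>i\<in>S. f i)"
  by (induction S rule: infinite_finite_induct)
    (auto intro: independent_of_mult simp: independent_of_altdef[of _ 1])

lemma independent_of_det:
  assumes A: "A \<in> carrier_mat n n"
    and "\<And>i j. i < n \<Longrightarrow> j < n \<Longrightarrow> independent_of v (A $$ (i, j))"
  shows "independent_of v (det A)"
  unfolding det_def'[OF A]
proof (rule independent_of_sum)
  fix p assume "p \<in> {p. p permutes {0..<n}}"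
  then have p: "p permutes {0..<n}" by simp
  have "independent_of v (\<Prod>i = 0..<n. A $$ (i, p i))"
    using permutes_in_image[OF p] by (intro independent_of_prod assms) auto
  then show "independent_of v (signof p * (\<Prod>i = 0..<n. A $$ (i, p i)))"
    by (cases "evenperm p") (simp_all add: sign_def independent_of_altdef)
qed

lemma mpoly_free_coeff_P_poly:
  assumes "\<And>j. mpoly_free v (fps_nth s j)"
  shows "mpoly_free v (coeff (P_poly s m) i)"
  using assms
proof (induction s m arbitrary: i rule: P_poly.induct)
  case (3 s m)
  then show ?case
    by (auto simp: coeff_trunc fps_mult_nth intro!: mpoly_free_sum mpoly_free_mult)
qed (auto simp: coeff_pCons split: nat.split)

lemma independent_of_Q_poly:
  assumes "\<And>j. mpoly_free v (fps_nth s j)"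
  shows "independent_of v (Q_poly s m)"
  unfolding independent_of_altdef Q_poly_def coeff_sum
  using mpoly_free_coeff_P_poly[OF assms] by (auto intro!: mpoly_free_sum)

lemma independent_of_det_hankel_Q_poly:
  "independent_of 1 (det (hankel (Q_poly (generic_fps :: 'a::comm_ring_1 mpoly_nat fps)) 1 n))"
proof -
  define e :: "'a mpoly_nat" where "e = indet 1"
  \<comment> \<open>Removing the linear term leaves a series free of the indeterminate with index 1,
    which then enters only as the parameter of the binomial transform.\<close>
  define r where "r = generic_fps - fps_const e * fps_X"
  have "fps_nth r j = (if j = 1 then 0 else indet j)" for j
    by (auto simp: r_def generic_fps_def e_def)
  then have "mpoly_free 1 (fps_nth r j)" for j
    by (simp add: mpoly_free_indet)
  then have "independent_of 1 (det (hankel (Q_poly r) 1 n))"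
    by (intro independent_of_det[of _ n]) (auto simp: hankel_def intro: independent_of_Q_poly)
  moreover have "generic_fps = r + fps_const e * fps_X"
    by (simp add: r_def)
  then have "det (hankel (Q_poly generic_fps) 1 n) = det (hankel (Q_poly r) 1 n)"
    by (intro det_hankel_binomial_transform[where e = "[:e:]"] Q_poly_add_linear)
  ultimately show ?thesis by simp
qed

theorem mainTheorem3:
  shows "(\<forall>(a :: nat \<Rightarrow> 'a::field_char_0) k n. k > 0 \<longrightarrow> n \<ge> 1 \<longrightarrow>
           degree (det (hankel (I_poly a) k n)) \<le> k) \<and>
         (\<forall>n \<ge> 1. independent_of 1
           (det (hankel (Q_poly (generic_fps :: 'a mpoly_nat fps)) 1 n)))"
  by (intro conjI allI impI degree_det_hankel_I_poly independent_of_det_hankel_Q_poly)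

end
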